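(* Let $S$ be a Clifford semigroup, and for every $e\in\mathrm{E}(S)$ let $s^{[e]}(a,b)=\left(ab,\theta^{[e]}_a(b)\right)$ be a solution on the group $G_e$. Moreover, for all $e,f\in\mathrm{E}(S)$, let $\epsilon_{e,f}:G_e\to G_f$ be maps such that $\epsilon_{e,f}=\varphi_{e,f}$ if $e\ge f$. Suppose that $$\theta^{[h]}_{\epsilon_{ef,h}(ab)}=\theta^{[h]}_{\epsilon_{e,h}(a)\,\epsilon_{f,h}(b)},$$ $$\epsilon_{f,h}\,\theta^{[f]}_{\epsilon_{e,f}(a)}(b)=\theta^{[h]}_{\epsilon_{e,h}(a)}\,\epsilon_{f,h}(b),$$ for all $e,f,h\in\mathrm{E}(S)$, $a\in G_e$ and $b\in G_f$. Set $$\theta_a(b):=\theta^{[f]}_{\epsilon_{e,f}(a)}(b)$$ for all $e,f\in\mathrm{E}(S)$, $a\in G_e$ and $b\in G_f$. Then the map $s:S\times S\to S\times S$ given by $s(a,b)=(ab,\theta_a(b))$ is an idempotent-fixed solution on $S$.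
   Context: A semigroup $S$ is inverse if for each $a\in S$ there is a unique $a^{-1}\in S$ with $aa^{-1}a=a$ and $a^{-1}aa^{-1}=a^{-1}$; it is a Clifford semigroup if moreover its idempotents are central (equivalently $aa^{-1}=a^{-1}a$ for all $a$). $\mathrm{E}(S)$ is the set of idempotents, ordered by $e\le f$ iff $e=ef=fe$. For $e\in\mathrm{E}(S)$, $G_e=\{x\in S\mid xx^{-1}=e\}$ is a group with identity $e$, and $S$ is the disjoint union of the groups $G_e$, $e\in\mathrm{E}(S)$. For $a\in G_e$, $b\in G_f$ one has $ab\in G_{ef}$. For $e\ge f$ in $\mathrm{E}(S)$, $\varphi_{e,f}:G_e\to G_f$ is the group homomorphism $\varphi_{e,f}(x)=fx$. A solution (of the pentagon equation) on a semigroup $S$ is a map $s:S\times S\to S\times S$, $s(a,b)=(ab,\theta_a(b))$, where $ab$ is the product of $S$ and $\theta_a:S\to S$ are maps satisfying $\theta_a(b)\theta_{ab}(c)=\theta_a(bc)$ and $\theta_{\theta_a(b)}\theta_{ab}=\theta_b$ (composition of maps) for all $a,b,c\in S$. A solution on $S$ is idempotent-fixed if $\theta_a(e)=e$ for all $a\in S$, $e\in\mathrm{E}(S)$. Juxtaposition of maps, as in $\epsilon_{f,h}\theta^{[f]}_{x}(b)$, denotes composition. *)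

theory Defs
  imports "HOL-Library.FuncSet"
begin

class inverse_semigroup = semigroup_mult +
  assumes semigroup_inverse_ex1: "\<exists>!b. a * b * a = a \<and> b * a * b = b"
begin

definition sinv :: "'a \<Rightarrow> 'a"
  where "sinv a = (THE b. a * b * a = a \<and> b * a * b = b)"

definition idems :: "'a set"
  where "idems = {e. e * e = e}"

definition idem_le :: "'a \<Rightarrow> 'a \<Rightarrow> bool"
  where "idem_le e f \<longleftrightarrow> e = e * f \<and> e = f * e"

definition grp_at :: "'a \<Rightarrow> 'a set"
  where "grp_at e = {x. x * sinv x = e}"

text \<open>The domain of \<open>\<phi>\<^bsub>e,f\<^esub>\<close> is \<open>G\<^sub>e\<close>, with \<open>f \<le> e\<close>; the
  formula itself does not mention \<open>e\<close>.\<close>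

definition str_hom :: "'a \<Rightarrow> 'a \<Rightarrow> 'a \<Rightarrow> 'a"
  where "str_hom e f x = f * x"

end

class clifford_semigroup = inverse_semigroup +
  assumes idem_central: "e * e = e \<Longrightarrow> e * x = x * e"

text \<open>Solutions are taken relative to a subset \<open>A\<close> of the ambient semigroup, so that the
  same notion applies to \<open>S\<close> (with \<open>A = UNIV\<close>) and to its subgroups
  \<open>G\<^sub>e\<close>; the values of \<open>s\<close> outside \<open>A \<times> A\<close> are irrelevant, and equations between
  maps are required on \<open>A\<close> only.  Here \<open>\<theta>\<^sub>a(b)\<close> is the second component of \<open>s(a, b)\<close>,
  and \<open>A\<close> is closed under products because \<open>s\<close> maps \<open>A \<times> A\<close> to itself.\<close>

definition theta_of :: "('a \<times> 'a \<Rightarrow> 'a \<times> 'a) \<Rightarrow> 'a \<Rightarrow> 'a \<Rightarrow> 'a"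
  where "theta_of s a b = snd (s (a, b))"

definition pentagon_solution_on ::
    "'a::semigroup_mult set \<Rightarrow> ('a \<times> 'a \<Rightarrow> 'a \<times> 'a) \<Rightarrow> bool"
  where "pentagon_solution_on A s \<longleftrightarrow>
    s \<in> A \<times> A \<rightarrow> A \<times> A \<and>
    (\<forall>a\<in>A. \<forall>b\<in>A. s (a, b) = (a * b, theta_of s a b)) \<and>
    (\<forall>a\<in>A. \<forall>b\<in>A. \<forall>c\<in>A.
      theta_of s a b * theta_of s (a * b) c = theta_of s a (b * c) \<and>
      theta_of s (theta_of s a b) (theta_of s (a * b) c) = theta_of s b c)"

definition idempotent_fixed ::
    "('a::inverse_semigroup \<times> 'a \<Rightarrow> 'a \<times> 'a) \<Rightarrow> bool"
  where "idempotent_fixed s \<longleftrightarrow> (\<forall>a. \<forall>e\<in>idems. theta_of s a e = e)"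

text \<open>Every element lies in exactly one \<open>G\<^sub>e\<close>; hence prescribing a map
  on all \<open>G\<^sub>e \<times> G\<^sub>f\<close> determines one and only one map on \<open>S \<times> S\<close>.\<close>

lemma grp_at_ex1:
  fixes x :: "'a::inverse_semigroup"
  shows "\<exists>!e. e \<in> idems \<and> x \<in> grp_at e"
proof -
  have "x * sinv x * x = x"
    using theI'[OF semigroup_inverse_ex1[of x]] unfolding sinv_def by blast
  then have "(x * sinv x) * (x * sinv x) = x * sinv x"
    by (metis mult.assoc)
  then show ?thesis
    unfolding idems_def grp_at_def by auto
qed

end

theory Submission
  imports Defs
begin

text \<open>For \<open>a \<in> G\<^sub>e\<close>, \<open>b \<in> G\<^sub>f\<close>, \<open>c \<in> G\<^sub>h\<close>, the second pentagon equation for \<open>s\<close> is the one in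
  \<open>G\<^sub>h\<close> at the images of \<open>a\<close>, \<open>b\<close> under the maps \<open>\<epsilon>\<close>.  The first one is obtained in \<open>G\<^sub>k\<close>, where
  \<open>k = f h\<close>: there \<open>b c = (k b) (k c)\<close>, and \<open>k b\<close>, \<open>k c\<close> are the images of \<open>b\<close>, \<open>c\<close> under \<open>\<epsilon>\<close>.  The
  idempotents are fixed because \<open>\<theta>\<^sub>x(1)\<close> is an idempotent of a group.\<close>

lemma sinv_props:
  fixes x :: "'a::inverse_semigroup"
  shows "x * sinv x * x = x" and "sinv x * x * sinv x = sinv x"
  using theI'[OF semigroup_inverse_ex1[of x]] unfolding sinv_def by blast+

lemma sinv_unique:
  fixes x y :: "'a::inverse_semigroup"
  assumes "x * y * x = x" and "y * x * y = y"
  shows "sinv x = y"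
  using assms sinv_props[of x] semigroup_inverse_ex1[of x] by blast

lemma idems_iff: "e \<in> idems \<longleftrightarrow> e * e = e"
  by (simp add: idems_def)

lemma idem_mem_grp_at:
  fixes e :: "'a::inverse_semigroup"
  assumes "e \<in> idems"
  shows "e \<in> grp_at e"
  using assms sinv_unique[of e e] by (simp add: idems_iff grp_at_def)

text \<open>An idempotent \<open>u\<close> is its own inverse, so \<open>u * sinv u\<close> is
  \<open>u\<close> itself.\<close>

lemma idem_in_grp_at_eq:
  fixes u :: "'a::inverse_semigroup"
  assumes "u \<in> grp_at f" and "u * u = u"
  shows "u = f"
  using assms sinv_unique[of u u] by (simp add: grp_at_def)

lemma grp_at_left_unit:
  fixes x :: "'a::inverse_semigroup"
  assumes "x \<in> grp_at e"
  shows "e * x = x"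
  using assms sinv_props(1)[of x] by (simp add: grp_at_def)

lemma idems_mult:
  fixes e f :: "'a::clifford_semigroup"
  assumes "e \<in> idems" and "f \<in> idems"
  shows "e * f \<in> idems"
  using assms idem_central[of e f] unfolding idems_iff by (metis mult.assoc)

text \<open>The idempotents \<open>y * sinv y\<close> and \<open>sinv x * x\<close> commute by
  centrality. Once swapped, each stands next to a factor that absorbs it.\<close>

lemma sinv_mult:
  fixes x y :: "'a::clifford_semigroup"
  shows "sinv (x * y) = sinv y * sinv x"
proof (rule sinv_unique)
  define p q where "p = y * sinv y" and "q = sinv x * x"
  have pp: "p * p = p" and qq: "q * q = q"
    unfolding p_def q_def by (metis mult.assoc sinv_props)+
  have "x * y * (sinv y * sinv x) * (x * y) = x * (p * q) * y"
    by (simp add: p_def q_def mult.assoc)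
  also have "\<dots> = (x * q) * (p * y)"
    using idem_central[OF pp, of q] by (simp add: mult.assoc)
  also have "\<dots> = x * y"
    using sinv_props[of x] sinv_props[of y] by (simp add: p_def q_def mult.assoc)
  finally show "x * y * (sinv y * sinv x) * (x * y) = x * y" .
  have "sinv y * sinv x * (x * y) * (sinv y * sinv x) = sinv y * (q * p) * sinv x"
    by (simp add: p_def q_def mult.assoc)
  also have "\<dots> = (sinv y * p) * (q * sinv x)"
    using idem_central[OF pp, of q, symmetric] by (simp add: mult.assoc)
  also have "\<dots> = sinv y * sinv x"
    using sinv_props[of x] sinv_props[of y] by (simp add: p_def q_def mult.assoc)
  finally show "sinv y * sinv x * (x * y) * (sinv y * sinv x) = sinv y * sinv x" .
qed

text \<open>By \<open>sinv_mult\<close>, the idempotent of \<open>x * y\<close> is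
  \<open>x * f * sinv x\<close>, and the central \<open>f\<close> can be moved out of it.\<close>

lemma grp_at_mult:
  fixes x y :: "'a::clifford_semigroup"
  assumes "x \<in> grp_at e" and "f \<in> idems" and "y \<in> grp_at f"
  shows "x * y \<in> grp_at (e * f)"
proof -
  have "x * y * sinv (x * y) = x * (y * sinv y) * sinv x"
    by (simp add: sinv_mult mult.assoc)
  also have "\<dots> = f * (x * sinv x)"
    using assms idem_central[of f x] unfolding grp_at_def idems_iff by (auto simp flip: mult.assoc)
  also have "\<dots> = e * f"
    using assms idem_central[of f e] by (simp add: grp_at_def idems_iff)
  finally show ?thesis
    by (simp add: grp_at_def)
qed

text \<open>This makes the maps \<open>eps\<close> from either factor to the product of two
  idempotents known: they are multiplication by that product.\<close>

lemma idem_le_mult: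
  fixes e f :: "'a::clifford_semigroup"
  assumes "e \<in> idems" and "f \<in> idems"
  shows "idem_le (e * f) e" and "idem_le (e * f) f"
  using assms idem_central[of e f] unfolding idem_le_def idems_iff
  by (metis mult.assoc)+

theorem theorem20:
  fixes th :: "'a::clifford_semigroup \<Rightarrow> 'a \<Rightarrow> 'a \<Rightarrow> 'a"
    and eps :: "'a \<Rightarrow> 'a \<Rightarrow> 'a \<Rightarrow> 'a"
    and \<theta> :: "'a \<Rightarrow> 'a \<Rightarrow> 'a"
    and s :: "'a \<times> 'a \<Rightarrow> 'a \<times> 'a"
  assumes "\<And>e. e \<in> idems \<Longrightarrow> pentagon_solution_on (grp_at e) (\<lambda>(a, b). (a * b, th e a b))"
    and "\<And>e f. e \<in> idems \<Longrightarrow> f \<in> idems \<Longrightarrow> eps e f \<in> grp_at e \<rightarrow> grp_at f"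
    and "\<And>e f x. e \<in> idems \<Longrightarrow> f \<in> idems \<Longrightarrow> idem_le f e \<Longrightarrow> x \<in> grp_at e \<Longrightarrow>
           eps e f x = str_hom e f x"
    and "\<And>e f h a b c. e \<in> idems \<Longrightarrow> f \<in> idems \<Longrightarrow> h \<in> idems \<Longrightarrow>
           a \<in> grp_at e \<Longrightarrow> b \<in> grp_at f \<Longrightarrow> c \<in> grp_at h \<Longrightarrow>
           th h (eps (e * f) h (a * b)) c = th h (eps e h a * eps f h b) c"
    and "\<And>e f h a b. e \<in> idems \<Longrightarrow> f \<in> idems \<Longrightarrow> h \<in> idems \<Longrightarrow>
           a \<in> grp_at e \<Longrightarrow> b \<in> grp_at f \<Longrightarrow>
           eps f h (th f (eps e f a) b) = th h (eps e h a) (eps f h b)"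
    and "\<And>e f a b. e \<in> idems \<Longrightarrow> f \<in> idems \<Longrightarrow> a \<in> grp_at e \<Longrightarrow> b \<in> grp_at f \<Longrightarrow>
           \<theta> a b = th f (eps e f a) b"
    and "\<And>a b. s (a, b) = (a * b, \<theta> a b)"
  shows "pentagon_solution_on UNIV s \<and> idempotent_fixed s"
proof -
  note sol = assms(1) and eps_mem = assms(2) and eps_hom = assms(3)
    and eps_mult = assms(4) and eps_th = assms(5) and \<theta>_eq = assms(6) and s_eq = assms(7)

  have th_mem: "th e x y \<in> grp_at e"
    if "e \<in> idems" "x \<in> grp_at e" "y \<in> grp_at e" for e x y
    using that sol[OF that(1)] unfolding pentagon_solution_on_def
    by (auto dest: funcset_mem[where x = "(x, y)"])

  have th_mult: "th e x y * th e (x * y) z = th e x (y * z)"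
    and th_comp: "th e (th e x y) (th e (x * y) z) = th e y z"
    if "e \<in> idems" "x \<in> grp_at e" "y \<in> grp_at e" "z \<in> grp_at e" for e x y z
    using sol[OF that(1)] that(2-4) unfolding pentagon_solution_on_def theta_of_def by auto

  have eps_in: "eps e f x \<in> grp_at f" if "e \<in> idems" "f \<in> idems" "x \<in> grp_at e" for e f x
    using eps_mem that by blast

  have \<theta>_mem: "\<theta> a b \<in> grp_at f"
    if "e \<in> idems" "f \<in> idems" "a \<in> grp_at e" "b \<in> grp_at f" for e f a b
    using that th_mem eps_in \<theta>_eq by metis

  have pentagon: "\<theta> a b * \<theta> (a * b) c = \<theta> a (b * c) \<and> \<theta> (\<theta> a b) (\<theta> (a * b) c) = \<theta> b c" for a b c
  proof -
    obtain e f h where e: "e \<in> idems" "a \<in> grp_at e" and f: "f \<in> idems" "b \<in> grp_at f"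
      and h: "h \<in> idems" "c \<in> grp_at h"
      using grp_at_ex1 by metis
    define k where "k = f * h"
    have k: "k \<in> idems" and ef: "e * f \<in> idems"
      using idems_mult e f h by (auto simp: k_def)
    have ab: "a * b \<in> grp_at (e * f)" and bc: "b * c \<in> grp_at k"
      using grp_at_mult e f h by (auto simp: k_def)
    have eps_k: "eps f k x = k * x" if "x \<in> grp_at f" for x
      using eps_hom[OF f(1) k _ that] idem_le_mult(1)[OF f(1) h(1)] by (simp add: k_def str_hom_def)
    have eps_k': "eps h k x = k * x" if "x \<in> grp_at h" for x
      using eps_hom[OF h(1) k _ that] idem_le_mult(2)[OF f(1) h(1)] by (simp add: k_def str_hom_def)
    \<comment> \<open>The two factors \<open>k\<close> merge into one by centrality, and that one is
      absorbed because \<open>k\<close> is the identity of the group containing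
      \<open>x * y\<close>.\<close>
    have k_mult: "(k * x) * (k * y) = x * y" if "x \<in> grp_at f" "y \<in> grp_at h" for x y
    proof -
      have "k * k = k" and "k * x = x * k"
        using k idem_central[of k x] by (auto simp: idems_iff)
      then have "(k * x) * (k * y) = k * (x * y)"
        by (metis mult.assoc)
      also have "\<dots> = x * y"
        using grp_at_left_unit grp_at_mult[OF that(1) h(1) that(2)] by (simp add: k_def)
      finally show ?thesis .
    qed
    note \<theta>ab = \<theta>_mem[OF e(1) f(1) e(2) f(2)]
    note \<theta>abc = \<theta>_mem[OF ef h(1) ab h(2)]
    let ?a = "eps e k a" and ?b = "eps f k b" and ?c = "eps h k c"
    have mem: "?a \<in> grp_at k" "?b \<in> grp_at k" "?c \<in> grp_at k"
      using eps_in e f h k by auto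
    \<comment> \<open>The second compatibility condition with target \<open>k\<close> gives
      \<open>eps f k (\<theta> a b)\<close>, which is a multiplication by \<open>k\<close> because
      \<open>\<theta> a b\<close> stays in \<open>grp_at f\<close>.\<close>
    have b_part: "th k ?a ?b = k * \<theta> a b"
      using eps_th[OF e(1) f(1) k e(2) f(2)] \<theta>_eq[OF e(1) f(1) e(2) f(2)] eps_k[OF \<theta>ab] by simp
    \<comment> \<open>The first condition trades \<open>?a * ?b\<close> for the image of
      \<open>a * b\<close> from \<open>grp_at (e * f)\<close>; the second then applies to the pair
      \<open>a * b\<close>, \<open>c\<close>.\<close>
    have c_part: "th k (?a * ?b) ?c = k * \<theta> (a * b) c"
      using eps_mult[OF e(1) f(1) k e(2) f(2) mem(3)] eps_th[OF ef h(1) k ab h(2)]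
        \<theta>_eq[OF ef h(1) ab h(2)] eps_k'[OF \<theta>abc] by simp
    have "\<theta> a (b * c) = th k ?a (b * c)"
      by (rule \<theta>_eq[OF e(1) k e(2) bc])
    also have "\<dots> = th k ?a (?b * ?c)"
      using k_mult f(2) h(2) by (simp add: eps_k eps_k')
    also have "\<dots> = th k ?a ?b * th k (?a * ?b) ?c"
      by (rule th_mult[OF k mem, symmetric])
    \<comment> \<open>\<open>k_mult\<close> serves again, now to remove \<open>k\<close> from the
      values of \<open>\<theta>\<close>, which lie in \<open>grp_at f\<close> and
      \<open>grp_at h\<close>.\<close>
    also have "\<dots> = \<theta> a b * \<theta> (a * b) c"
      using b_part c_part k_mult[OF \<theta>ab \<theta>abc] by simp
    finally have first: "\<theta> a b * \<theta> (a * b) c = \<theta> a (b * c)" ..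

    let ?x = "eps e h a" and ?y = "eps f h b"
    have mem': "?x \<in> grp_at h" "?y \<in> grp_at h"
      using eps_in e f h by auto
    have "eps f h (\<theta> a b) = th h ?x ?y"
      using eps_th[OF e(1) f(1) h(1) e(2) f(2)] \<theta>_eq[OF e(1) f(1) e(2) f(2)] by simp
    moreover have "\<theta> (a * b) c = th h (?x * ?y) c"
      using \<theta>_eq[OF ef h(1) ab h(2)] eps_mult[OF e(1) f(1) h(1) e(2) f(2) h(2)] by simp
    \<comment> \<open>The outer index \<open>\<theta> a b\<close> lies in \<open>grp_at f\<close>,
      so it acts on \<open>grp_at h\<close> through its image under \<open>eps f h\<close>, computed
      above.\<close>
    ultimately have "\<theta> (\<theta> a b) (\<theta> (a * b) c) = th h (th h ?x ?y) (th h (?x * ?y) c)"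
      using \<theta>_eq[OF f(1) h(1) \<theta>ab \<theta>abc] by simp
    also have "\<dots> = th h ?y c"
      by (rule th_comp[OF h(1) mem' h(2)])
    also have "\<dots> = \<theta> b c"
      by (rule \<theta>_eq[OF f(1) h(1) f(2) h(2), symmetric])
    finally show ?thesis
      using first by blast
  qed

  have fixed: "\<theta> a f = f" if f: "f \<in> idems" for a f
  proof -
    obtain e where e: "e \<in> idems" "a \<in> grp_at e"
      using grp_at_ex1 by metis
    note ff = idem_mem_grp_at[OF f]
    define x where "x = eps e f a"
    have x: "x \<in> grp_at f"
      using eps_in e f by (simp add: x_def)
    have "f * f = f" and "x * f = x"
      using f idem_central[of f x] grp_at_left_unit[OF x] by (auto simp: idems_iff)
    \<comment> \<open>This is the first equation in \<open>grp_at f\<close> at \<open>x\<close>,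
      \<open>f\<close>, \<open>f\<close>, with \<open>f\<close> as the identity.\<close>
    then have "th f x f * th f x f = th f x f"
      using th_mult[OF f x ff ff] by simp
    then show ?thesis
      using idem_in_grp_at_eq[OF th_mem[OF f x ff]] \<theta>_eq[OF e(1) f e(2) ff] by (simp add: x_def)
  qed

  have "theta_of s a b = \<theta> a b" for a b
    by (simp add: theta_of_def s_eq)
  then show ?thesis
    using pentagon fixed by (simp add: pentagon_solution_on_def idempotent_fixed_def s_eq)
qed

end
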